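(* Let $1<p<\infty$ and $0<\gamma<1$, let $\{f_i\}\subset L^p_+(X)$ be a sequence and let $f\in L^p_+(X)$. Each of the following statements is a consequence of the previous one (that is, (i) implies (ii), and (ii) implies (iii)): (i) $f_i\to f$ in $L^p(X)$; (ii) $I_\gamma f_i\to I_\gamma f$ in $\mathcal{C}_{\gamma,p}$; (iii) there exists a subsequence $\{f_{i_j}\}$ of $\{f_i\}$ such that $I_\gamma f_{i_j}\to I_\gamma f$ pointwise $\mathcal{C}_{\gamma,p}$-q.e.
   Context: Setting: $X=(X,d,\mu)$ is a locally compact metric space equipped with a Borel regular outer measure $\mu$ that is doubling, i.e. there is a constant $c_d\ge 1$ with $\mu(B(x,2r))\le c_d\,\mu(B(x,r))$ for every ball $B(x,r)=\{y\in X: d(y,x)<r\}$. Every open ball has positive and finite measure. Spheres have measure zero, $\mu(\{y\in X: d(x,y)=r\})=0$ for all $x\in X$, $r>0$, and points have measure zero, $\mu(\{x\})=0$ for all $x\in X$. For $0<\gamma<1$, the Riesz potential of order $\gamma$ of a measurable function $f$ is $$I_\gamma f(x)=\int_X \frac{f(y)}{\mu(B(x,d(x,y)))^{1-\gamma}}\,d\mu(y)$$ (the single point $y=x$ may be omitted from the domain of integration, since it is $\mu$-null). $L^p_+(X)$ denotes the set of non-negative functions in $L^p(X)=L^p(X,\mu)$. For $1<p<\infty$ and any $E\subset X$, the Riesz $(\gamma,p)$-capacity is $\mathcal{C}_{\gamma,p}(E)=\inf_{f\in\mathcal{A}(E)}\|f\|_{L^p(X)}^p$, where $\mathcal{A}(E)=\{f\in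 L^p_+(X): I_\gamma f\ge 1\text{ on }E\}$ and $\mathcal{C}_{\gamma,p}(E)=\infty$ if $\mathcal{A}(E)=\emptyset$. A property holds $\mathcal{C}_{\gamma,p}$-q.e. if it holds for all $x\in X$ except those in a set $E$ with $\mathcal{C}_{\gamma,p}(E)=0$. A sequence $\{g_i\}$ of functions converges in capacity to $g$, written $g_i\to g$ in $\mathcal{C}_{\gamma,p}$, if for every $\epsilon>0$, $\lim_{i\to\infty}\mathcal{C}_{\gamma,p}(\{x\in X:|g_i(x)-g(x)|>\epsilon\})=0$. (Potentials of functions in $L^p_+(X)$ are finite $\mathcal{C}_{\gamma,p}$-q.e., so such differences are defined outside a set of capacity zero.) *)

theory Defs
  imports "HOL-Analysis.Analysis"
begin

text \<open>The measure induced by an outer measure on its Caratheodory-measurable sets; measurability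
  and integration always refer to it.\<close>

definition induced_measure :: "('a set \<Rightarrow> ennreal) \<Rightarrow> 'a measure" where
  "induced_measure \<mu> = measure_of UNIV (lambda_system UNIV UNIV \<mu>) \<mu>"

lemma
  assumes "outer_measure_space UNIV \<mu>"
  shows space_induced_measure: "space (induced_measure \<mu>) = UNIV"
    and sets_induced_measure: "sets (induced_measure \<mu>) = lambda_system UNIV UNIV \<mu>"
    and emeasure_induced_measure:
      "A \<in> lambda_system UNIV UNIV \<mu> \<Longrightarrow> emeasure (induced_measure \<mu>) A = \<mu> A"
proof -
  interpret sigma_algebra UNIV "UNIV :: 'a set set"
    using sigma_algebra_Pow[of UNIV] by simp
  have ms: "measure_space UNIV (lambda_system UNIV UNIV \<mu>) \<mu>"
    by (rule caratheodory_lemma[OF assms])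
  then have sa: "sigma_algebra UNIV (lambda_system UNIV UNIV \<mu>)"
    by (simp add: measure_space_def)
  show "space (induced_measure \<mu>) = UNIV"
    by (simp add: induced_measure_def)
  show "sets (induced_measure \<mu>) = lambda_system UNIV UNIV \<mu>"
    by (simp add: induced_measure_def sigma_algebra.sets_measure_of_eq[OF sa])
  show "A \<in> lambda_system UNIV UNIV \<mu> \<Longrightarrow> emeasure (induced_measure \<mu>) A = \<mu> A"
    unfolding induced_measure_def
    using ms by (intro emeasure_measure_of_sigma) (auto simp: measure_space_def)
qed

definition borel_regular :: "('a::topological_space set \<Rightarrow> ennreal) \<Rightarrow> bool" where
  "borel_regular \<mu> \<longleftrightarrow>
     sets borel \<subseteq> lambda_system UNIV UNIV \<mu> \<and>
     (\<forall>A. \<exists>B\<in>sets borel. A \<subseteq> B \<and> \<mu> B = \<mu> A)"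

definition doubling :: "('a::metric_space set \<Rightarrow> ennreal) \<Rightarrow> bool" where
  "doubling \<mu> \<longleftrightarrow>
     (\<exists>c::real. c \<ge> 1 \<and> (\<forall>x r. r > 0 \<longrightarrow> \<mu> (ball x (2 * r)) \<le> ennreal c * \<mu> (ball x r)))"

locale doubling_space =
  fixes \<mu> :: "'a::metric_space set \<Rightarrow> ennreal"
  assumes locally_compact: "locally_compact_space (euclidean :: 'a topology)"
    and outer_measure: "outer_measure_space UNIV \<mu>"
    and regular: "borel_regular \<mu>"
    and doubling: "doubling \<mu>"
    and ball_pos: "\<And>x r. r > 0 \<Longrightarrow> \<mu> (ball x r) > 0"
    and ball_finite: "\<And>x r. r > 0 \<Longrightarrow> \<mu> (ball x r) < \<infinity>"
    and sphere_null: "\<And>x r. r > 0 \<Longrightarrow> \<mu> (sphere x r) = 0"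
    and point_null: "\<And>x. \<mu> {x} = 0"

definition Lp :: "('a set \<Rightarrow> ennreal) \<Rightarrow> real \<Rightarrow> ('a \<Rightarrow> real) set" where
  "Lp \<mu> p = {f \<in> borel_measurable (induced_measure \<mu>).
     integrable (induced_measure \<mu>) (\<lambda>x. \<bar>f x\<bar> powr p)}"

definition Lp_plus :: "('a set \<Rightarrow> ennreal) \<Rightarrow> real \<Rightarrow> ('a \<Rightarrow> real) set" where
  "Lp_plus \<mu> p = {f \<in> Lp \<mu> p. \<forall>x. f x \<ge> 0}"

text \<open>Meaningful for members of \<^const>\<open>Lp\<close> only (the Bochner integral of a non-integrable
  function is 0).\<close>

definition Lp_norm :: "('a set \<Rightarrow> ennreal) \<Rightarrow> real \<Rightarrow> ('a \<Rightarrow> real) \<Rightarrow> real" where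
  "Lp_norm \<mu> p f = (LINT x|induced_measure \<mu>. \<bar>f x\<bar> powr p) powr (1 / p)"

text \<open>Meaningful for non-negative \<open>f\<close> only (\<^const>\<open>ennreal\<close> truncates negative values to 0); the
  value may be infinite. The point \<open>x\<close> is omitted, as the ball is empty for \<open>y = x\<close>.\<close>

definition riesz_potential ::
    "('a::metric_space set \<Rightarrow> ennreal) \<Rightarrow> real \<Rightarrow> ('a \<Rightarrow> real) \<Rightarrow> 'a \<Rightarrow> ennreal" where
  "riesz_potential \<mu> \<gamma> f x =
     (\<integral>\<^sup>+ y \<in> - {x}. ennreal (f y / enn2real (\<mu> (ball x (dist x y))) powr (1 - \<gamma>))
        \<partial>induced_measure \<mu>)"

definition admissible ::
    "('a::metric_space set \<Rightarrow> ennreal) \<Rightarrow> real \<Rightarrow> real \<Rightarrow> 'a set \<Rightarrow> ('a \<Rightarrow> real) set" where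
  "admissible \<mu> \<gamma> p E = {f \<in> Lp_plus \<mu> p. \<forall>x\<in>E. riesz_potential \<mu> \<gamma> f x \<ge> 1}"

text \<open>The infimum over the empty set is \<open>\<infinity>\<close> in \<^typ>\<open>ennreal\<close>.\<close>

definition riesz_capacity ::
    "('a::metric_space set \<Rightarrow> ennreal) \<Rightarrow> real \<Rightarrow> real \<Rightarrow> 'a set \<Rightarrow> ennreal" where
  "riesz_capacity \<mu> \<gamma> p E = (INF f\<in>admissible \<mu> \<gamma> p E. ennreal (Lp_norm \<mu> p f powr p))"

definition quasi_everywhere ::
    "('a::metric_space set \<Rightarrow> ennreal) \<Rightarrow> real \<Rightarrow> real \<Rightarrow> ('a \<Rightarrow> bool) \<Rightarrow> bool" where
  "quasi_everywhere \<mu> \<gamma> p P \<longleftrightarrow>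
     (\<exists>E. riesz_capacity \<mu> \<gamma> p E = 0 \<and> (\<forall>x. x \<notin> E \<longrightarrow> P x))"

text \<open>The functions are extended-real valued. In \<^typ>\<open>ereal\<close> the difference \<open>\<infinity> - \<infinity>\<close> is \<open>\<infinity>\<close>, so
  every point where \<open>g i\<close> or \<open>h\<close> is \<open>\<infinity>\<close> belongs to the exceptional set below. For potentials of
  functions in \<^const>\<open>Lp_plus\<close> those points form a set of capacity zero, hence (the capacity being
  subadditive) including or excluding them makes no difference.\<close>

definition converges_in_capacity ::
    "('a::metric_space set \<Rightarrow> ennreal) \<Rightarrow> real \<Rightarrow> real \<Rightarrow> (nat \<Rightarrow> 'a \<Rightarrow> ereal) \<Rightarrow> ('a \<Rightarrow> ereal) \<Rightarrow> bool"
    where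
  "converges_in_capacity \<mu> \<gamma> p g h \<longleftrightarrow>
     (\<forall>\<epsilon>::real. \<epsilon> > 0 \<longrightarrow>
       (\<lambda>i. riesz_capacity \<mu> \<gamma> p {x. \<bar>g i x - h x\<bar> > ereal \<epsilon>}) \<longlonglongrightarrow> 0)"

end

theory Submission
  imports Defs
begin

text \<open>
  The map \<open>f \<mapsto> I\<^sub>\<gamma> f\<close> is a positive linear operator given by a non-negative kernel, and the
  capacity is built from it so that it obeys two inequalities, which carry the whole proof.

  The first is a weak-type estimate (\<open>riesz_capacity_superlevel_le\<close>): if \<open>I\<^sub>\<gamma> f \<ge> t\<close> on a set,
  then \<open>f / t\<close> is a competitor for the capacity of that set, which is therefore at most
  \<open>(\<parallel>f\<parallel> / t) ^ p\<close>. Letting \<open>t \<rightarrow> \<infinity>\<close>, potentials are finite quasi-everywhere.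
  Since \<open>\<bar>I\<^sub>\<gamma> f\<^sub>i - I\<^sub>\<gamma> f\<bar> \<le> I\<^sub>\<gamma> \<bar>f\<^sub>i - f\<bar>\<close> wherever the potentials are finite, norm convergence
  gives convergence in capacity.

  The second is countable subadditivity (\<open>riesz_capacity_countably_subadditive\<close>): if \<open>h\<^sub>i\<close> competes
  for \<open>E\<^sub>i\<close>, then \<open>(\<Sum>i. h\<^sub>i ^ p) ^ (1 / p)\<close> dominates every \<open>h\<^sub>i\<close>, hence competes for the union, and
  the \<open>p\<close>-th power of its norm is at most the sum of those of the \<open>h\<^sub>i\<close>. It yields a Borel--Cantelli lemma,
  and the usual argument that convergence in measure implies almost everywhere
  convergence of a subsequence then carries over to the capacity.
\<close>

section \<open>Powers of the norm as integrals\<close>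

lemma Lp_iff_nn_integral_finite:
  "f \<in> Lp \<mu> p \<longleftrightarrow> f \<in> borel_measurable (induced_measure \<mu>) \<and>
     (\<integral>\<^sup>+x. ennreal (\<bar>f x\<bar> powr p) \<partial>induced_measure \<mu>) < \<infinity>"
  by (auto simp: Lp_def integrable_iff_bounded)

lemma Lp_norm_powr_eq_nn_integral:
  assumes "f \<in> Lp \<mu> p" "p > 0"
  shows "ennreal (Lp_norm \<mu> p f powr p) = (\<integral>\<^sup>+x. ennreal (\<bar>f x\<bar> powr p) \<partial>induced_measure \<mu>)"
proof -
  have "Lp_norm \<mu> p f powr p = (LINT x|induced_measure \<mu>. \<bar>f x\<bar> powr p)"
    using assms by (simp add: Lp_norm_def powr_powr)
  then show ?thesis
    using assms by (simp add: Lp_def nn_integral_eq_integral)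
qed

lemma Lp_norm_divide:
  assumes "t > 0" "p > 0"
  shows "Lp_norm \<mu> p (\<lambda>x. f x / t) = Lp_norm \<mu> p f / t"
proof -
  have "(\<lambda>x. \<bar>f x / t\<bar> powr p) = (\<lambda>x. \<bar>f x\<bar> powr p / t powr p)"
    using assms by (simp add: powr_divide)
  then show ?thesis
    using assms by (simp add: Lp_norm_def powr_divide powr_powr)
qed

lemma Lp_plus_divide:
  assumes "f \<in> Lp_plus \<mu> p" "t > 0"
  shows "(\<lambda>x. f x / t) \<in> Lp_plus \<mu> p"
proof -
  have "(\<lambda>x. \<bar>f x / t\<bar> powr p) = (\<lambda>x. \<bar>f x\<bar> powr p / t powr p)"
    using assms by (simp add: powr_divide)
  then show ?thesis
    using assms by (auto simp: Lp_plus_def Lp_def)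
qed

lemma abs_diff_in_Lp_plus:
  assumes "f \<in> Lp_plus \<mu> p" "g \<in> Lp_plus \<mu> p" "p > 0"
  shows "(\<lambda>x. \<bar>f x - g x\<bar>) \<in> Lp_plus \<mu> p"
proof -
  have [measurable]: "f \<in> borel_measurable (induced_measure \<mu>)" "g \<in> borel_measurable (induced_measure \<mu>)"
    using assms(1,2) by (auto simp: Lp_plus_def Lp_def)
  have le: "\<bar>\<bar>f x - g x\<bar>\<bar> powr p \<le> \<bar>f x\<bar> powr p + \<bar>g x\<bar> powr p" for x
  proof -
    have nonneg: "f x \<ge> 0" "g x \<ge> 0"
      using assms by (auto simp: Lp_plus_def)
    have "\<bar>f x - g x\<bar> powr p \<le> (max (f x) (g x)) powr p"
      using nonneg assms(3) by (intro powr_mono2) auto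
    also have "\<dots> \<le> \<bar>f x\<bar> powr p + \<bar>g x\<bar> powr p"
      using nonneg by (auto simp: max_def)
    finally show ?thesis by simp
  qed
  have "integrable (induced_measure \<mu>) (\<lambda>x. \<bar>f x\<bar> powr p + \<bar>g x\<bar> powr p)"
    using assms(1,2) by (auto simp: Lp_plus_def Lp_def)
  then have "integrable (induced_measure \<mu>) (\<lambda>x. \<bar>\<bar>f x - g x\<bar>\<bar> powr p)"
    by (rule Bochner_Integration.integrable_bound) (use le in auto)
  then show ?thesis
    by (auto simp: Lp_plus_def Lp_def)
qed

section \<open>The potential as a positive linear operator\<close>

definition riesz_kernel :: "('a::metric_space set \<Rightarrow> ennreal) \<Rightarrow> real \<Rightarrow> 'a \<Rightarrow> 'a \<Rightarrow> ennreal" where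
  "riesz_kernel \<mu> \<gamma> x y =
     ennreal (1 / enn2real (\<mu> (ball x (dist x y))) powr (1 - \<gamma>)) * indicator (- {x}) y"

lemma riesz_potential_eq_kernel_integral:
  assumes "\<And>y. f y \<ge> 0"
  shows "riesz_potential \<mu> \<gamma> f x = (\<integral>\<^sup>+y. ennreal (f y) * riesz_kernel \<mu> \<gamma> x y \<partial>induced_measure \<mu>)"
proof -
  have "ennreal (f y / c) = ennreal (f y) * ennreal (1 / c)" if "c \<ge> 0" for y c
    using assms that by (simp flip: ennreal_mult)
  then show ?thesis
    by (simp add: riesz_potential_def riesz_kernel_def mult.assoc)
qed

lemma riesz_potential_mono_AE:
  assumes "\<And>y. f y \<ge> 0" "\<And>y. g y \<ge> 0" "AE y in induced_measure \<mu>. f y \<le> g y"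
  shows "riesz_potential \<mu> \<gamma> f x \<le> riesz_potential \<mu> \<gamma> g x"
  unfolding riesz_potential_eq_kernel_integral[OF assms(1)] riesz_potential_eq_kernel_integral[OF assms(2)]
  using assms(3) by (intro nn_integral_mono_AE) (auto intro!: mult_right_mono ennreal_leI)

context doubling_space
begin

lemma measurable_induced_measure_if_borel:
  assumes "f \<in> borel \<rightarrow>\<^sub>M N"
  shows "f \<in> induced_measure \<mu> \<rightarrow>\<^sub>M N"
proof -
  have "(\<lambda>x. x) \<in> induced_measure \<mu> \<rightarrow>\<^sub>M borel"
    using regular sets_induced_measure[OF outer_measure] space_induced_measure[OF outer_measure]
    by (auto simp: borel_regular_def measurable_def)
  from measurable_compose[OF this assms] show ?thesis .
qed

text \<open>The kernel depends on \<open>y\<close> only through \<open>dist x y\<close>, and monotonically so, which makes it a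
  Borel function of \<open>y\<close>.\<close>

lemma riesz_kernel_measurable [measurable]:
  "riesz_kernel \<mu> \<gamma> x \<in> borel_measurable (induced_measure \<mu>)"
proof -
  have "mono (\<lambda>r. enn2real (\<mu> (ball x r)))"
  proof (rule monoI)
    fix r s :: real assume "r \<le> s"
    have le: "\<mu> (ball x r) \<le> \<mu> (ball x s)"
      using outer_measure \<open>r \<le> s\<close>
      by (auto simp: outer_measure_space_def increasing_def subset_ball)
    show "enn2real (\<mu> (ball x r)) \<le> enn2real (\<mu> (ball x s))"
    proof (cases "s > 0")
      case True
      then show ?thesis
        using le ball_finite[of s x] by (intro enn2real_mono) auto
    next
      case False
      then have "ball x r = {}" "ball x s = {}"
        using \<open>r \<le> s\<close> by auto
      then show ?thesis by (simp only: order_refl)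
    qed
  qed
  from borel_measurable_mono[OF this]
  have [measurable]: "(\<lambda>r. enn2real (\<mu> (ball x r))) \<in> borel_measurable borel" .
  have "(\<lambda>y. enn2real (\<mu> (ball x (dist x y)))) \<in> borel_measurable borel"
    by (rule measurable_compose[of "dist x" _ borel, rotated])
       (auto intro!: borel_measurable_continuous_onI continuous_intros)
  then have "(\<lambda>y. riesz_kernel \<mu> \<gamma> x y) \<in> borel_measurable borel"
    unfolding riesz_kernel_def by measurable
  then show ?thesis
    by (rule measurable_induced_measure_if_borel)
qed

lemma riesz_potential_add:
  assumes [measurable]: "f \<in> borel_measurable (induced_measure \<mu>)" "g \<in> borel_measurable (induced_measure \<mu>)"
    and "\<And>y. f y \<ge> 0" "\<And>y. g y \<ge> 0"
  shows "riesz_potential \<mu> \<gamma> (\<lambda>y. f y + g y) x = riesz_potential \<mu> \<gamma> f x + riesz_potential \<mu> \<gamma> g x"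
  using assms(3,4)
  by (simp add: riesz_potential_eq_kernel_integral nn_integral_add distrib_right)

lemma riesz_potential_divide:
  assumes [measurable]: "f \<in> borel_measurable (induced_measure \<mu>)"
    and "\<And>y. f y \<ge> 0" "t > 0"
  shows "riesz_potential \<mu> \<gamma> (\<lambda>y. f y / t) x = riesz_potential \<mu> \<gamma> f x / ennreal t"
proof -
  have "riesz_potential \<mu> \<gamma> (\<lambda>y. f y / t) x =
      (\<integral>\<^sup>+y. (ennreal (f y) * riesz_kernel \<mu> \<gamma> x y) / ennreal t \<partial>induced_measure \<mu>)"
    using assms(2,3)
    by (simp add: riesz_potential_eq_kernel_integral divide_ennreal[symmetric] ennreal_divide_times ennreal_times_divide mult.assoc)
  also have "\<dots> = riesz_potential \<mu> \<gamma> f x / ennreal t"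
    using assms(2) by (simp add: riesz_potential_eq_kernel_integral nn_integral_divide)
  finally show ?thesis .
qed

lemma riesz_potential_le_add_abs_diff:
  assumes "f \<in> Lp_plus \<mu> p" "g \<in> Lp_plus \<mu> p"
  shows "riesz_potential \<mu> \<gamma> f x \<le> riesz_potential \<mu> \<gamma> g x + riesz_potential \<mu> \<gamma> (\<lambda>y. \<bar>f y - g y\<bar>) x"
proof -
  have [measurable]: "f \<in> borel_measurable (induced_measure \<mu>)" "g \<in> borel_measurable (induced_measure \<mu>)"
    and nonneg: "\<And>y. f y \<ge> 0" "\<And>y. g y \<ge> 0"
    using assms by (auto simp: Lp_plus_def Lp_def)
  have "riesz_potential \<mu> \<gamma> f x \<le> riesz_potential \<mu> \<gamma> (\<lambda>y. g y + \<bar>f y - g y\<bar>) x"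
    using nonneg by (intro riesz_potential_mono_AE) auto
  also have "\<dots> = riesz_potential \<mu> \<gamma> g x + riesz_potential \<mu> \<gamma> (\<lambda>y. \<bar>f y - g y\<bar>) x"
    using nonneg by (intro riesz_potential_add) auto
  finally show ?thesis .
qed

section \<open>The capacity as an outer measure\<close>

lemma riesz_capacity_mono:
  assumes "A \<subseteq> B"
  shows "riesz_capacity \<mu> \<gamma> p A \<le> riesz_capacity \<mu> \<gamma> p B"
  unfolding riesz_capacity_def using assms by (intro INF_superset_mono) (auto simp: admissible_def)

text \<open>Near-optimal competitors \<open>h i\<close> for the \<open>E i\<close> are combined into
  \<open>H = (\<Sum>i. h i powr p) powr (1 / p)\<close>. The series may diverge, but only on a null set when the
  right-hand side is finite; as \<open>H\<close> has to be real valued it is set to 0 there, which the potential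
  does not see.\<close>

lemma riesz_capacity_countably_subadditive:
  assumes "p > 0"
  shows "riesz_capacity \<mu> \<gamma> p (\<Union>i. E i) \<le> (\<Sum>i. riesz_capacity \<mu> \<gamma> p (E i))"
proof (rule ennreal_le_epsilon)
  fix e :: real
  assume fin: "(\<Sum>i. riesz_capacity \<mu> \<gamma> p (E i)) < top" and "e > 0"
  let ?M = "induced_measure \<mu>"
  let ?c = "\<lambda>i. riesz_capacity \<mu> \<gamma> p (E i)"
  let ?e = "\<lambda>i. e * (1 / 2) ^ Suc i"
  have "\<exists>h. h \<in> admissible \<mu> \<gamma> p (E i) \<and>
      (\<integral>\<^sup>+y. ennreal (\<bar>h y\<bar> powr p) \<partial>?M) \<le> ?c i + ennreal (?e i)" for i
  proof -
    have "?c i < top"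
      using fin by (metis ennreal_suminf_lessD top.not_eq_extremum)
    then have "?c i < ?c i + ennreal (?e i)"
      using \<open>e > 0\<close> by (simp add: ennreal_lessI flip: ennreal_add_left_cancel_less)
    then obtain h where h: "h \<in> admissible \<mu> \<gamma> p (E i)"
        and "ennreal (Lp_norm \<mu> p h powr p) < ?c i + ennreal (?e i)"
      unfolding riesz_capacity_def[of \<mu> \<gamma> p "E i"] INF_less_iff by auto
    moreover have "h \<in> Lp \<mu> p"
      using h by (simp add: admissible_def Lp_plus_def)
    ultimately show ?thesis
      using Lp_norm_powr_eq_nn_integral[of h \<mu> p] assms by (intro exI[of _ h]) auto
  qed
  then obtain h where h: "\<And>i. h i \<in> admissible \<mu> \<gamma> p (E i)"
    and h_le: "\<And>i. (\<integral>\<^sup>+y. ennreal (\<bar>h i y\<bar> powr p) \<partial>?M) \<le> ?c i + ennreal (?e i)"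
    by metis
  have [measurable]: "h i \<in> borel_measurable ?M" for i
    using h[of i] by (simp add: admissible_def Lp_plus_def Lp_def)
  have h_nonneg: "h i y \<ge> 0" for i y
    using h[of i] by (simp add: admissible_def Lp_plus_def)
  define F where "F y = (\<Sum>i. ennreal (\<bar>h i y\<bar> powr p))" for y
  define H where "H y = enn2real (F y) powr (1 / p)" for y
  have [measurable]: "F \<in> borel_measurable ?M"
    unfolding F_def by measurable
  have "?e sums e"
    using sums_mult[OF power_half_series, of e] by simp
  then have sum_e: "(\<Sum>i. ennreal (?e i)) = ennreal e"
    using \<open>e > 0\<close> by (intro suminf_ennreal_eq) auto
  have "(\<integral>\<^sup>+y. F y \<partial>?M) = (\<Sum>i. \<integral>\<^sup>+y. ennreal (\<bar>h i y\<bar> powr p) \<partial>?M)"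
    unfolding F_def by (intro nn_integral_suminf) measurable
  also have "\<dots> \<le> (\<Sum>i. ?c i + ennreal (?e i))"
    by (intro suminf_le h_le) auto
  also have "\<dots> = (\<Sum>i. ?c i) + ennreal e"
    by (simp add: suminf_add[symmetric] sum_e del: power_Suc)
  finally have F_le: "(\<integral>\<^sup>+y. F y \<partial>?M) \<le> (\<Sum>i. ?c i) + ennreal e" .
  also have "\<dots> < top"
    using fin by simp
  finally have F_finite: "AE y in ?M. F y \<noteq> \<infinity>"
    by (intro nn_integral_noteq_infinite) auto
  have "ennreal (\<bar>H y\<bar> powr p) \<le> F y" for y
    using assms by (simp add: H_def powr_powr ennreal_enn2real_if)
  then have H_le: "(\<integral>\<^sup>+y. ennreal (\<bar>H y\<bar> powr p) \<partial>?M) \<le> (\<Sum>i. ?c i) + ennreal e"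
    using F_le by (meson nn_integral_mono order_trans)
  have H_Lp: "H \<in> Lp \<mu> p"
    unfolding Lp_iff_nn_integral_finite
  proof
    show "H \<in> borel_measurable ?M"
      unfolding H_def by measurable
    show "(\<integral>\<^sup>+y. ennreal (\<bar>H y\<bar> powr p) \<partial>?M) < \<infinity>"
      using H_le fin by (auto intro: le_less_trans)
  qed
  have h_le_H: "AE y in ?M. h i y \<le> H y" for i
    using F_finite
  proof eventually_elim
    case (elim y)
    have "(\<Sum>j\<in>{i}. ennreal (\<bar>h j y\<bar> powr p)) \<le> F y"
      unfolding F_def by (intro sum_le_suminf) auto
    then have "ennreal (h i y powr p) \<le> F y"
      using h_nonneg[of i y] by simp
    moreover have "F y < top"
      using elim by (simp add: less_top)
    ultimately have "h i y powr p \<le> enn2real (F y)"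
      using enn2real_mono[of "ennreal (h i y powr p)" "F y"] by simp
    then have "(h i y powr p) powr (1 / p) \<le> H y"
      unfolding H_def using assms by (intro powr_mono2) auto
    then show ?case
      using assms h_nonneg[of i y] by (simp add: powr_powr)
  qed
  have "H \<in> admissible \<mu> \<gamma> p (\<Union>i. E i)"
  proof -
    have "1 \<le> riesz_potential \<mu> \<gamma> H x" if "x \<in> E i" for x i
    proof -
      have "1 \<le> riesz_potential \<mu> \<gamma> (h i) x"
        using h[of i] that by (simp add: admissible_def)
      also have "\<dots> \<le> riesz_potential \<mu> \<gamma> H x"
        using h_nonneg h_le_H by (intro riesz_potential_mono_AE) (auto simp: H_def)
      finally show ?thesis .
    qed
    moreover have "H y \<ge> 0" for y
      by (simp add: H_def)
    ultimately show ?thesis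
      using H_Lp by (auto simp: admissible_def Lp_plus_def)
  qed
  then have "riesz_capacity \<mu> \<gamma> p (\<Union>i. E i) \<le> ennreal (Lp_norm \<mu> p H powr p)"
    unfolding riesz_capacity_def by (rule INF_lower)
  also have "\<dots> \<le> (\<Sum>i. ?c i) + ennreal e"
    using Lp_norm_powr_eq_nn_integral[OF H_Lp assms] H_le by simp
  finally show "riesz_capacity \<mu> \<gamma> p (\<Union>i. E i) \<le> (\<Sum>i. ?c i) + ennreal e" .
qed

lemma riesz_capacity_Un_null:
  assumes "p > 0" "riesz_capacity \<mu> \<gamma> p N = 0"
  shows "riesz_capacity \<mu> \<gamma> p (A \<union> N) \<le> riesz_capacity \<mu> \<gamma> p A"
proof -
  have "A \<union> N = (\<Union>i::nat. if i = 0 then A else N)"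
    by (auto split: if_splits intro: exI[of _ 0] exI[of _ 1])
  then have "riesz_capacity \<mu> \<gamma> p (A \<union> N) \<le> (\<Sum>i::nat. riesz_capacity \<mu> \<gamma> p (if i = 0 then A else N))"
    using riesz_capacity_countably_subadditive[OF assms(1), of \<gamma> "\<lambda>i. if i = 0 then A else N"] by simp
  also have "\<dots> = (\<Sum>i\<in>{0::nat}. riesz_capacity \<mu> \<gamma> p (if i = 0 then A else N))"
    using assms(2) by (intro suminf_finite) auto
  finally show ?thesis by simp
qed

lemma riesz_capacity_Borel_Cantelli:
  assumes "p > 0" "(\<Sum>i. riesz_capacity \<mu> \<gamma> p (E i)) < \<infinity>"
  shows "riesz_capacity \<mu> \<gamma> p (limsup E) = 0"
proof -
  define c where "c i = enn2real (riesz_capacity \<mu> \<gamma> p (E i))" for i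
  have "riesz_capacity \<mu> \<gamma> p (E i) < top" for i
    using assms(2) by (metis ennreal_suminf_lessD infinity_ennreal_def)
  then have c: "riesz_capacity \<mu> \<gamma> p (E i) = ennreal (c i)" for i
    by (simp add: c_def)
  have c_nonneg: "c i \<ge> 0" for i
    by (simp add: c_def)
  have "summable c"
    using assms(2) c_nonneg by (intro summable_suminf_not_top) (auto simp: c)
  have "riesz_capacity \<mu> \<gamma> p (limsup E) \<le> ennreal (\<Sum>i. c (k + i))" for k
  proof -
    have "limsup E \<subseteq> (\<Union>i. E (k + i))"
    proof
      fix x assume "x \<in> limsup E"
      then obtain n where "n \<ge> k" "x \<in> E n"
        unfolding limsup_INF_SUP by auto
      then show "x \<in> (\<Union>i. E (k + i))"
        by (intro UN_I[of "n - k"]) auto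
    qed
    then have "riesz_capacity \<mu> \<gamma> p (limsup E) \<le> riesz_capacity \<mu> \<gamma> p (\<Union>i. E (k + i))"
      by (rule riesz_capacity_mono)
    also have "\<dots> \<le> (\<Sum>i. ennreal (c (k + i)))"
      using riesz_capacity_countably_subadditive[OF assms(1), of \<gamma> "\<lambda>i. E (k + i)"] by (simp add: c)
    also have "\<dots> = ennreal (\<Sum>i. c (k + i))"
      using c_nonneg \<open>summable c\<close> by (intro suminf_ennreal2) (auto simp: add.commute summable_iff_shift)
    finally show ?thesis .
  qed
  moreover have "(\<lambda>k. ennreal (\<Sum>i. c (k + i))) \<longlonglongrightarrow> ennreal 0"
    using suminf_exist_split2[OF \<open>summable c\<close>] by (intro tendsto_ennrealI) (simp add: add.commute)
  ultimately have "riesz_capacity \<mu> \<gamma> p (limsup E) \<le> 0"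
    by (intro LIMSEQ_le_const[of _ _ "riesz_capacity \<mu> \<gamma> p (limsup E)"]) auto
  then show ?thesis by simp
qed

section \<open>Norm convergence implies convergence in capacity\<close>

lemma riesz_capacity_superlevel_le:
  assumes "f \<in> Lp_plus \<mu> p" "p > 0" "t > 0"
  shows "riesz_capacity \<mu> \<gamma> p {x. riesz_potential \<mu> \<gamma> f x \<ge> ennreal t} \<le> ennreal ((Lp_norm \<mu> p f / t) powr p)"
proof -
  have f: "f \<in> borel_measurable (induced_measure \<mu>)" "\<And>y. f y \<ge> 0"
    using assms(1) by (auto simp: Lp_plus_def Lp_def)
  have "1 \<le> a / ennreal t" if "ennreal t \<le> a" for a
    using divide_right_mono_ennreal[OF that, of "ennreal t"] assms(3) by simp
  then have "(\<lambda>y. f y / t) \<in> admissible \<mu> \<gamma> p {x. riesz_potential \<mu> \<gamma> f x \<ge> ennreal t}"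
    using assms(3) f Lp_plus_divide[OF assms(1,3)] by (auto simp: admissible_def riesz_potential_divide)
  then have "riesz_capacity \<mu> \<gamma> p {x. riesz_potential \<mu> \<gamma> f x \<ge> ennreal t}
      \<le> ennreal (Lp_norm \<mu> p (\<lambda>y. f y / t) powr p)"
    unfolding riesz_capacity_def by (rule INF_lower)
  then show ?thesis
    using assms by (simp add: Lp_norm_divide)
qed

lemma riesz_capacity_potential_infinite:
  assumes "f \<in> Lp_plus \<mu> p" "p > 0"
  shows "riesz_capacity \<mu> \<gamma> p {x. riesz_potential \<mu> \<gamma> f x = \<infinity>} = 0"
proof -
  have "riesz_capacity \<mu> \<gamma> p {x. riesz_potential \<mu> \<gamma> f x = \<infinity>}
      \<le> ennreal ((Lp_norm \<mu> p f / real (Suc n)) powr p)" for n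
    by (rule order_trans[OF riesz_capacity_mono riesz_capacity_superlevel_le[OF assms]]) auto
  moreover have "(\<lambda>n. ennreal ((Lp_norm \<mu> p f / real (Suc n)) powr p)) \<longlonglongrightarrow> ennreal (0 powr p)"
    using assms(2)
    by (intro tendsto_ennrealI tendsto_powr' tendsto_const LIMSEQ_Suc[OF lim_const_over_n])
       (auto simp: Lp_norm_def)
  ultimately have "riesz_capacity \<mu> \<gamma> p {x. riesz_potential \<mu> \<gamma> f x = \<infinity>} \<le> 0"
    by (intro LIMSEQ_le_const[of _ _ "riesz_capacity \<mu> \<gamma> p {x. riesz_potential \<mu> \<gamma> f x = \<infinity>}"]) auto
  then show ?thesis by simp
qed

end

lemma abs_diff_ennreal_le:
  assumes "a \<le> b + c" "b \<le> a + c" "b < \<infinity>" "c < ennreal e"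
  shows "\<bar>enn2ereal a - enn2ereal b\<bar> \<le> ereal e"
proof -
  have "c < \<infinity>"
    using assms(4) by (auto intro: less_trans)
  then have "a < \<infinity>"
    using assms(1,3) by (auto intro: le_less_trans)
  obtain b' where b': "b = ennreal b'" "b' \<ge> 0"
    using assms(3) by (metis ennreal_cases infinity_ennreal_def less_irrefl)
  obtain c' where c': "c = ennreal c'" "c' \<ge> 0"
    using \<open>c < \<infinity>\<close> by (metis ennreal_cases infinity_ennreal_def less_irrefl)
  obtain a' where a': "a = ennreal a'" "a' \<ge> 0"
    using \<open>a < \<infinity>\<close> by (metis ennreal_cases infinity_ennreal_def less_irrefl)
  have "a' \<le> b' + c'" "b' \<le> a' + c'" "c' < e"
    using assms a' b' c' by (auto simp: ennreal_less_iff simp flip: ennreal_plus)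
  then show ?thesis
    using a' b' by (simp add: enn2ereal_ennreal)
qed

lemma (in doubling_space) converges_in_capacity_if_Lp_norm_tendsto_0:
  assumes "p > 0" and f: "\<And>i. f i \<in> Lp_plus \<mu> p" and f0: "f0 \<in> Lp_plus \<mu> p"
    and lim: "(\<lambda>i. Lp_norm \<mu> p (\<lambda>x. f i x - f0 x)) \<longlonglongrightarrow> 0"
  shows "converges_in_capacity \<mu> \<gamma> p
    (\<lambda>i x. enn2ereal (riesz_potential \<mu> \<gamma> (f i) x)) (\<lambda>x. enn2ereal (riesz_potential \<mu> \<gamma> f0 x))"
  unfolding converges_in_capacity_def
proof (intro allI impI)
  fix e :: real assume "e > 0"
  define g where "g i = (\<lambda>x. \<bar>f i x - f0 x\<bar>)" for i
  define E where "E i = {x. \<bar>enn2ereal (riesz_potential \<mu> \<gamma> (f i) x) - enn2ereal (riesz_potential \<mu> \<gamma> f0 x)\<bar> > ereal e}" for i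
  let ?N = "{x. riesz_potential \<mu> \<gamma> f0 x = \<infinity>}"
  let ?S = "\<lambda>i. {x. riesz_potential \<mu> \<gamma> (g i) x \<ge> ennreal e}"
  have g: "g i \<in> Lp_plus \<mu> p" for i
    unfolding g_def using f f0 assms(1) by (rule abs_diff_in_Lp_plus)
  \<comment> \<open>On \<open>?N\<close>, a set of capacity zero, the difference of the potentials is not controlled
    by the potential of the difference.\<close>
  have "E i \<subseteq> ?S i \<union> ?N" for i
  proof
    fix x assume "x \<in> E i"
    have "riesz_potential \<mu> \<gamma> (f i) x \<le> riesz_potential \<mu> \<gamma> f0 x + riesz_potential \<mu> \<gamma> (g i) x"
      unfolding g_def using f f0 by (rule riesz_potential_le_add_abs_diff)
    moreover have "riesz_potential \<mu> \<gamma> f0 x \<le> riesz_potential \<mu> \<gamma> (f i) x + riesz_potential \<mu> \<gamma> (g i) x"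
      unfolding g_def using riesz_potential_le_add_abs_diff[OF f0 f] by (simp add: abs_minus_commute)
    ultimately have "\<not> (riesz_potential \<mu> \<gamma> f0 x < \<infinity> \<and> riesz_potential \<mu> \<gamma> (g i) x < ennreal e)"
      using abs_diff_ennreal_le \<open>x \<in> E i\<close> unfolding E_def mem_Collect_eq not_le[symmetric] by blast
    then show "x \<in> ?S i \<union> ?N"
      by (auto simp: not_less less_top[symmetric])
  qed
  then have "riesz_capacity \<mu> \<gamma> p (E i) \<le> riesz_capacity \<mu> \<gamma> p (?S i \<union> ?N)" for i
    by (rule riesz_capacity_mono)
  also have "riesz_capacity \<mu> \<gamma> p (?S i \<union> ?N) \<le> riesz_capacity \<mu> \<gamma> p (?S i)" for i
    using assms(1) riesz_capacity_potential_infinite[OF f0 assms(1)] by (rule riesz_capacity_Un_null)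
  also have "riesz_capacity \<mu> \<gamma> p (?S i) \<le> ennreal ((Lp_norm \<mu> p (g i) / e) powr p)" for i
    using g assms(1) \<open>e > 0\<close> by (rule riesz_capacity_superlevel_le)
  finally have "riesz_capacity \<mu> \<gamma> p (E i) \<le> ennreal ((Lp_norm \<mu> p (g i) / e) powr p)" for i .
  moreover have "(\<lambda>i. ennreal ((Lp_norm \<mu> p (g i) / e) powr p)) \<longlonglongrightarrow> 0"
  proof -
    have "(\<lambda>i. Lp_norm \<mu> p (g i) / e) \<longlonglongrightarrow> 0"
      using tendsto_divide[OF lim tendsto_const[of e]] \<open>e > 0\<close> by (simp add: g_def Lp_norm_def)
    then have "(\<lambda>i. (Lp_norm \<mu> p (g i) / e) powr p) \<longlonglongrightarrow> 0 powr p"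
      using assms(1) \<open>e > 0\<close> by (intro tendsto_powr' tendsto_const) (auto simp: Lp_norm_def)
    from tendsto_ennrealI[OF this] show ?thesis by simp
  qed
  ultimately have "(\<lambda>i. riesz_capacity \<mu> \<gamma> p (E i)) \<longlonglongrightarrow> 0"
    using tendsto_sandwich[of "\<lambda>i. 0" "\<lambda>i. riesz_capacity \<mu> \<gamma> p (E i)" sequentially
        "\<lambda>i. ennreal ((Lp_norm \<mu> p (g i) / e) powr p)" 0] by simp
  then show "(\<lambda>i. riesz_capacity \<mu> \<gamma> p {x. \<bar>enn2ereal (riesz_potential \<mu> \<gamma> (f i) x) -
      enn2ereal (riesz_potential \<mu> \<gamma> f0 x)\<bar> > ereal e}) \<longlonglongrightarrow> 0"
    by (simp add: E_def)
qed

section \<open>Convergence in capacity implies quasi-everywhere convergence of a subsequence\<close>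

lemma ennreal_le_add_if_abs_diff_le:
  assumes "\<bar>enn2ereal a - enn2ereal b\<bar> \<le> ereal e"
  shows "b < \<infinity>" "a \<le> b + ennreal e" "b - ennreal e \<le> a"
proof -
  have inf1: "\<bar>s - \<infinity>\<bar> = \<infinity>" for s :: ereal
    by (cases s) auto
  have "b \<noteq> \<infinity>"
  proof
    assume "b = \<infinity>"
    then have "enn2ereal b = \<infinity>" by simp
    with assms show False by (simp add: inf1)
  qed
  then obtain b' where b': "b = ennreal b'" "b' \<ge> 0"
    by (metis ennreal_cases infinity_ennreal_def)
  have inf2: "\<bar>\<infinity> - s\<bar> = \<infinity>" for s :: ereal
    by (cases s) auto
  have "a \<noteq> \<infinity>"
  proof
    assume "a = \<infinity>"
    then have "enn2ereal a = \<infinity>" by simp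
    with assms show False by (simp add: inf2)
  qed
  then obtain a' where a': "a = ennreal a'" "a' \<ge> 0"
    by (metis ennreal_cases infinity_ennreal_def)
  have e: "\<bar>a' - b'\<bar> \<le> e"
    using assms a' b' by (simp add: enn2ereal_ennreal)
  show "b < \<infinity>" "b - ennreal e \<le> a"
    using a' b' e by (auto simp: ennreal_minus intro!: ennreal_leI)
  show "a \<le> b + ennreal e"
    using a' b' e by (auto intro!: ennreal_leI simp flip: ennreal_plus)
qed

text \<open>In \<^typ>\<open>ereal\<close> every difference involving \<open>\<infinity>\<close>, even \<open>\<infinity> - \<infinity>\<close>, has infinite absolute value.
  The bound therefore makes \<open>b\<close> finite, and \<open>b \<plusminus> e j\<close> squeezes \<open>a j\<close>.\<close>

lemma tendsto_ennreal_if_abs_diff_le: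
  assumes "\<forall>\<^sub>F j in sequentially. \<bar>enn2ereal (a j) - enn2ereal b\<bar> \<le> ereal (e j)"
    and "e \<longlonglongrightarrow> 0"
  shows "a \<longlonglongrightarrow> b"
proof -
  have e: "(\<lambda>j. ennreal (e j)) \<longlonglongrightarrow> 0"
    using tendsto_ennrealI[OF assms(2)] by simp
  obtain j where "\<bar>enn2ereal (a j) - enn2ereal b\<bar> \<le> ereal (e j)"
    using eventually_happens'[OF _ assms(1)] by auto
  then have "b \<noteq> \<infinity>"
    using ennreal_le_add_if_abs_diff_le(1) by blast
  show ?thesis
  proof (rule tendsto_sandwich)
    show "\<forall>\<^sub>F j in sequentially. b - ennreal (e j) \<le> a j"
      using assms(1) by eventually_elim (rule ennreal_le_add_if_abs_diff_le)
    show "\<forall>\<^sub>F j in sequentially. a j \<le> b + ennreal (e j)"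
      using assms(1) by eventually_elim (rule ennreal_le_add_if_abs_diff_le)
    show "(\<lambda>j. b - ennreal (e j)) \<longlonglongrightarrow> b"
      using tendsto_diff_ennreal[OF tendsto_const e, of b] \<open>b \<noteq> \<infinity>\<close> by simp
    show "(\<lambda>j. b + ennreal (e j)) \<longlonglongrightarrow> b"
      using tendsto_add[OF tendsto_const e, of b] by simp
  qed
qed

text \<open>The subsequence is chosen so that the \<open>j\<close>-th potential deviates by more than \<open>2 ^ - j\<close> only on
  a set of capacity at most \<open>2 ^ - j\<close>. The capacities are summable, so quasi-every point lies in only
  finitely many of these sets.\<close>

lemma (in doubling_space) subsequence_tendsto_quasi_everywhere:
  fixes u :: "nat \<Rightarrow> 'a \<Rightarrow> ennreal"
  assumes "p > 0"
    and conv: "converges_in_capacity \<mu> \<gamma> p (\<lambda>i x. enn2ereal (u i x)) (\<lambda>x. enn2ereal (v x))"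
  shows "\<exists>r::nat \<Rightarrow> nat. strict_mono r \<and> quasi_everywhere \<mu> \<gamma> p (\<lambda>x. (\<lambda>j. u (r j) x) \<longlonglongrightarrow> v x)"
proof -
  define D where "D i j = {x. \<bar>enn2ereal (u i x) - enn2ereal (v x)\<bar> > ereal ((1 / 2) ^ j)}" for i j :: nat
  have ev: "\<forall>\<^sub>F i in sequentially. riesz_capacity \<mu> \<gamma> p (D i j) < ennreal ((1 / 2) ^ j)" for j
  proof -
    have "(\<lambda>i. riesz_capacity \<mu> \<gamma> p (D i j)) \<longlonglongrightarrow> 0"
      using conv unfolding converges_in_capacity_def D_def by simp
    then show ?thesis
      by (rule order_tendstoD) simp
  qed
  have "\<exists>r. \<forall>j. riesz_capacity \<mu> \<gamma> p (D (r j) j) < ennreal ((1 / 2) ^ j) \<and> r j < r (Suc j)"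
  proof (rule dependent_nat_choice)
    show "\<exists>i. riesz_capacity \<mu> \<gamma> p (D i 0) < ennreal ((1 / 2) ^ 0)"
      using eventually_happens'[OF sequentially_bot ev[of 0]] .
    show "\<exists>i'. riesz_capacity \<mu> \<gamma> p (D i' (Suc j)) < ennreal ((1 / 2) ^ Suc j) \<and> i < i'" for i j
      using eventually_happens'[OF sequentially_bot eventually_conj[OF ev[of "Suc j"] eventually_gt_at_top[of i]]] .
  qed
  then obtain r where r: "\<And>j. riesz_capacity \<mu> \<gamma> p (D (r j) j) < ennreal ((1 / 2) ^ j)"
    and "\<And>j. r j < r (Suc j)"
    by blast
  then have "strict_mono r"
    by (simp add: strict_mono_Suc_iff)
  let ?E = "limsup (\<lambda>j. D (r j) j)"
  have "(\<Sum>j. riesz_capacity \<mu> \<gamma> p (D (r j) j)) \<le> (\<Sum>j. ennreal ((1 / 2) ^ j))"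
    using r by (intro suminf_le) (auto intro: less_imp_le)
  also have "\<dots> = ennreal (\<Sum>j. (1 / 2) ^ j)"
    by (intro suminf_ennreal2 summable_geometric) auto
  also have "\<dots> < \<infinity>"
    by simp
  finally have "riesz_capacity \<mu> \<gamma> p ?E = 0"
    using assms(1) by (intro riesz_capacity_Borel_Cantelli)
  moreover have "(\<lambda>j. u (r j) x) \<longlonglongrightarrow> v x" if "x \<notin> ?E" for x
  proof (rule tendsto_ennreal_if_abs_diff_le)
    show "\<forall>\<^sub>F j in sequentially. \<bar>enn2ereal (u (r j) x) - enn2ereal (v x)\<bar> \<le> ereal ((1 / 2) ^ j)"
      using that unfolding limsup_INF_SUP eventually_sequentially by (auto simp: D_def not_less)
    show "(\<lambda>j. (1 / 2) ^ j :: real) \<longlonglongrightarrow> 0"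
      by (rule LIMSEQ_power_zero) simp
  qed
  ultimately show ?thesis
    using \<open>strict_mono r\<close> unfolding quasi_everywhere_def by blast
qed

section \<open>Convergence of potentials\<close>

theorem theorem3p9:
  fixes \<mu> :: "'a::metric_space set \<Rightarrow> ennreal"
    and p \<gamma> :: real
    and f :: "nat \<Rightarrow> 'a \<Rightarrow> real"
    and f0 :: "'a \<Rightarrow> real"
  assumes "doubling_space \<mu>"
    and "1 < p" and "0 < \<gamma>" and "\<gamma> < 1"
    and "\<And>i. f i \<in> Lp_plus \<mu> p"
    and "f0 \<in> Lp_plus \<mu> p"
  shows "((\<lambda>i. Lp_norm \<mu> p (\<lambda>x. f i x - f0 x)) \<longlonglongrightarrow> 0 \<longrightarrow>
           converges_in_capacity \<mu> \<gamma> p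
             (\<lambda>i x. enn2ereal (riesz_potential \<mu> \<gamma> (f i) x))
             (\<lambda>x. enn2ereal (riesz_potential \<mu> \<gamma> f0 x))) \<and>
         (converges_in_capacity \<mu> \<gamma> p
             (\<lambda>i x. enn2ereal (riesz_potential \<mu> \<gamma> (f i) x))
             (\<lambda>x. enn2ereal (riesz_potential \<mu> \<gamma> f0 x)) \<longrightarrow>
           (\<exists>r::nat \<Rightarrow> nat. strict_mono r \<and>
              quasi_everywhere \<mu> \<gamma> p
                (\<lambda>x. (\<lambda>j. riesz_potential \<mu> \<gamma> (f (r j)) x) \<longlonglongrightarrow> riesz_potential \<mu> \<gamma> f0 x)))"
proof -
  interpret doubling_space \<mu> by fact
  have "p > 0" using \<open>1 < p\<close> by simp
  show ?thesis
    using converges_in_capacity_if_Lp_norm_tendsto_0[where f = f, OF \<open>p > 0\<close> assms(5,6)]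
      subsequence_tendsto_quasi_everywhere[where u = "\<lambda>i. riesz_potential \<mu> \<gamma> (f i)"
        and v = "riesz_potential \<mu> \<gamma> f0", OF \<open>p > 0\<close>]
    by (intro conjI impI)
qed

end
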